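(* Every $\omega$-approximable total function $f:\omega\to\omega$ is bounded-Turing reducible to some total function approximable from above.
   Context: $f$ is $\omega$-approximable if $f(x)=\lim_s g(x,s)$ for some total computable $g$ and there is a total computable $h$ with $|\{s:g(x,s)\ne g(x,s+1)\}|\le h(x)$ for all $x$. A total function is approximable from above if it is $\lim_s g(x,s)$ for a total computable $g$ with $g(x,s+1)\le g(x,s)$ for all $x,s$. For total $\alpha,\beta:\omega\to\omega$, $\alpha\le_{bT}\beta$ if there are a Turing reduction $\Phi$ using $\beta$ as a function oracle (queried for values $\beta(y)$) and a total computable $b$ such that for each $x$, $\Phi$ computes $\alpha(x)$ querying only values $\beta(y)$ with $y<b(x)$. *)

theory Defs
  imports Complex_Main
begin

section \<open>Oracle computations\<close>

text \<open>
  Programs are terms for the functions partial recursive in a function oracle: the usual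
  schemes for partial recursive functions together with a call to the oracle.
\<close>

datatype prog =
    Zero
  | Succ
  | Proj nat
  | Oracle
  | Comp prog "prog list"
  | PrimRec prog prog
  | Mu prog

text \<open>
  \<open>computes \<beta> U e xs v\<close>: with oracle \<open>\<beta>\<close>, program \<open>e\<close> halts on input \<open>xs\<close> with output \<open>v\<close>,
  and every number \<open>y\<close> whose value \<open>\<beta> y\<close> is queried along the way lies in \<open>U\<close>.
  In \<open>mu\<close>, the subcomputations below the least zero all have to halt, with nonzero output.
\<close>

inductive computes :: "(nat \<Rightarrow> nat) \<Rightarrow> nat set \<Rightarrow> prog \<Rightarrow> nat list \<Rightarrow> nat \<Rightarrow> bool"
  for \<beta> :: "nat \<Rightarrow> nat" and U :: "nat set" where
  zero: "computes \<beta> U Zero xs 0"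
| succ: "computes \<beta> U Succ [x] (Suc x)"
| proj: "i < length xs \<Longrightarrow> computes \<beta> U (Proj i) xs (xs ! i)"
| query: "y \<in> U \<Longrightarrow> computes \<beta> U Oracle [y] (\<beta> y)"
| comp: "list_all2 (\<lambda>d. computes \<beta> U d xs) ds ys \<Longrightarrow> computes \<beta> U e ys v
    \<Longrightarrow> computes \<beta> U (Comp e ds) xs v"
| primrec_0: "computes \<beta> U d xs v \<Longrightarrow> computes \<beta> U (PrimRec d e) (0 # xs) v"
| primrec_Suc: "computes \<beta> U (PrimRec d e) (n # xs) r \<Longrightarrow> computes \<beta> U e (n # r # xs) v
    \<Longrightarrow> computes \<beta> U (PrimRec d e) (Suc n # xs) v"
| mu: "computes \<beta> U e (n # xs) 0 \<Longrightarrow> (\<And>m. m < n \<Longrightarrow> \<exists>k. computes \<beta> U e (m # xs) (Suc k))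
    \<Longrightarrow> computes \<beta> U (Mu e) xs n"

inductive_cases computes_ZeroE: "computes \<beta> U Zero xs v"
inductive_cases computes_SuccE: "computes \<beta> U Succ xs v"
inductive_cases computes_ProjE: "computes \<beta> U (Proj i) xs v"
inductive_cases computes_OracleE: "computes \<beta> U Oracle xs v"
inductive_cases computes_CompE: "computes \<beta> U (Comp e ds) xs v"
inductive_cases computes_PrimRec0E: "computes \<beta> U (PrimRec d e) (0 # xs) v"
inductive_cases computes_PrimRecSucE: "computes \<beta> U (PrimRec d e) (Suc n # xs) v"
inductive_cases computes_MuE: "computes \<beta> U (Mu e) xs v"

lemma computes_deterministic:
  "computes \<beta> U e xs v \<Longrightarrow> computes \<beta> U e xs w \<Longrightarrow> v = w"
proof (induction arbitrary: w rule: computes.induct)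
  case (zero xs)
  then show ?case by (rule computes_ZeroE) simp
next
  case (succ x)
  then show ?case by (rule computes_SuccE) simp
next
  case (proj i xs)
  from proj.prems show ?case by (rule computes_ProjE) simp
next
  case (query y)
  from query.prems show ?case by (rule computes_OracleE) simp
next
  case (comp xs ds ys e v)
  from comp.prems obtain zs where zs: "list_all2 (\<lambda>d. computes \<beta> U d xs) ds zs"
    and w: "computes \<beta> U e zs w"
    by (rule computes_CompE)
  have "ys = zs"
  proof (rule nth_equalityI)
    show "length ys = length zs"
      using list_all2_lengthD[OF comp.IH(1)] list_all2_lengthD[OF zs] by (rule trans[OF sym])
  next
    fix i assume "i < length ys"
    then show "ys ! i = zs ! i"
      using list_all2_nthD[OF comp.IH(1)] list_all2_nthD2[OF zs] list_all2_lengthD[OF comp.IH(1)]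
        list_all2_lengthD[OF zs] by metis
  qed
  then show ?case
    using comp.IH(2) w by blast
next
  case (primrec_0 d xs v e)
  from primrec_0.prems have "computes \<beta> U d xs w" by (rule computes_PrimRec0E)
  then show ?case by (rule primrec_0.IH)
next
  case (primrec_Suc d e n xs r v)
  from primrec_Suc.prems obtain r' where r': "computes \<beta> U (PrimRec d e) (n # xs) r'"
    and w: "computes \<beta> U e (n # r' # xs) w"
    by (rule computes_PrimRecSucE)
  from primrec_Suc.IH(1)[OF r'] w show ?case
    by (intro primrec_Suc.IH(2)) simp
next
  case (mu e n xs)
  from mu.prems have zero_w: "computes \<beta> U e (w # xs) 0"
    and below_w: "\<And>m. m < w \<Longrightarrow> \<exists>k. computes \<beta> U e (m # xs) (Suc k)"
    by (rule computes_MuE, blast)+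
  have "\<not> n < w"
    using below_w mu.IH(1) by (metis nat.distinct(1))
  moreover have "\<not> w < n"
    using mu.IH(2) zero_w by (metis nat.distinct(1))
  ultimately show ?case by simp
qed


section \<open>Total computable functions\<close>

text \<open>No oracle query is permitted here, so the choice of the oracle is immaterial.\<close>

definition computable :: "(nat \<Rightarrow> nat) \<Rightarrow> bool" where
  "computable f \<longleftrightarrow> (\<exists>e. \<forall>x. computes (\<lambda>_. 0) {} e [x] (f x))"

definition computable2 :: "(nat \<Rightarrow> nat \<Rightarrow> nat) \<Rightarrow> bool" where
  "computable2 g \<longleftrightarrow> (\<exists>e. \<forall>x s. computes (\<lambda>_. 0) {} e [x, s] (g x s))"


section \<open>Approximations and bounded Turing reducibility\<close>

text \<open>Limits are taken in the discrete topology of \<^typ>\<open>nat\<close>.\<close>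

definition omega_approximable :: "(nat \<Rightarrow> nat) \<Rightarrow> bool" where
  "omega_approximable f \<longleftrightarrow>
    (\<exists>g h. computable2 g \<and> computable h \<and> (\<forall>x. (\<lambda>s. g x s) \<longlonglongrightarrow> f x) \<and>
      (\<forall>x. finite {s. g x s \<noteq> g x (Suc s)} \<and> card {s. g x s \<noteq> g x (Suc s)} \<le> h x))"

definition approximable_from_above :: "(nat \<Rightarrow> nat) \<Rightarrow> bool" where
  "approximable_from_above f \<longleftrightarrow>
    (\<exists>g. computable2 g \<and> (\<forall>x. (\<lambda>s. g x s) \<longlonglongrightarrow> f x) \<and> (\<forall>x s. g x (Suc s) \<le> g x s))"

definition bT_reducible :: "(nat \<Rightarrow> nat) \<Rightarrow> (nat \<Rightarrow> nat) \<Rightarrow> bool" (infix "\<le>\<^sub>b\<^sub>T" 50) where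
  "\<alpha> \<le>\<^sub>b\<^sub>T \<beta> \<longleftrightarrow> (\<exists>e b. computable b \<and> (\<forall>x. computes \<beta> {y. y < b x} e [x] (\<alpha> x)))"

end

theory Submission imports Defs begin

text \<open>
  Let \<open>h\<close> bound the number of mind changes of the approximation \<open>g\<close> of \<open>f\<close>, and let \<open>\<beta> x\<close> be
  \<open>h x\<close> minus the number of mind changes of \<open>g\<close> on \<open>x\<close>. Subtracting only the changes seen
  before stage \<open>s\<close> approximates \<open>\<beta>\<close> from above. Knowing \<open>\<beta> x\<close>, one can search for a stage
  at which all changes have been seen; there \<open>g\<close> has reached its limit \<open>f x\<close>. The only
  query is \<open>\<beta> x\<close>.
\<close>

text \<open>With no query permitted, a run never consults the oracle, so it stays valid for every
  oracle and every query set. Programs of computable functions can thus be reused inside a reduction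
  to \<open>\<beta>\<close>.\<close>

lemma computes_mono:
  assumes "computes (\<lambda>_. 0) {} e xs v"
  shows "computes \<beta> U e xs v"
  using assms
proof induction
  case (comp xs ds ys e v)
  then have "list_all2 (\<lambda>d. computes \<beta> U d xs) ds ys"
    by (auto elim: list_all2_mono)
  with comp.IH(2) show ?case
    by (blast intro: computes.comp)
next
  case (mu e n xs)
  from mu.IH show ?case
    by (intro computes.mu) blast+
qed (auto intro: computes.intros)

lemma computes_Comp1:
  "computes \<beta> U e [y] v \<Longrightarrow> computes \<beta> U d xs y \<Longrightarrow> computes \<beta> U (Comp e [d]) xs v"
  by (rule computes.comp[where ys = "[y]"]) auto

lemma computes_Comp2:
  "computes \<beta> U e [y, y'] v \<Longrightarrow> computes \<beta> U d xs y \<Longrightarrow> computes \<beta> U d' xs y'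
    \<Longrightarrow> computes \<beta> U (Comp e [d, d']) xs v"
  by (rule computes.comp[where ys = "[y, y']"]) auto

lemma computes_Proj: "i < length xs \<Longrightarrow> v = xs ! i \<Longrightarrow> computes \<beta> U (Proj i) xs v"
  by (simp add: computes.proj)

text \<open>Here \<open>r\<close> is the intended course of values: the step program has to be
  correct only along it, not on arbitrary intermediate values.\<close>

lemma computes_PrimRec:
  assumes "computes \<beta> U d xs (r 0)"
    and "\<And>n. computes \<beta> U e (n # r n # xs) (r (Suc n))"
  shows "computes \<beta> U (PrimRec d e) (n # xs) (r n)"
  by (induction n) (use assms in \<open>blast intro: computes.primrec_0 computes.primrec_Suc\<close>)+

definition pred_prog :: prog where
  "pred_prog = PrimRec Zero (Proj 0)"

lemma computes_pred: "computes \<beta> U pred_prog [n] (n - 1)"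
  unfolding pred_prog_def
  by (rule computes_PrimRec) (auto intro: computes.zero computes_Proj)

definition sgn_prog :: prog where
  "sgn_prog = PrimRec Zero (Comp Succ [Zero])"

lemma computes_sgn: "computes \<beta> U sgn_prog [n] (of_bool (n \<noteq> 0))"
  unfolding sgn_prog_def
  by (rule computes_PrimRec)
    (simp_all add: computes.zero computes_Comp1[OF computes.succ[of _ _ 0, simplified]])

text \<open>The predecessor is iterated along the subtrahend. Since \<open>PrimRec\<close> recurses
  on the first argument, the two inputs are swapped.\<close>

definition monus_prog :: prog where
  "monus_prog = Comp (PrimRec (Proj 0) (Comp pred_prog [Proj 1])) [Proj 1, Proj 0]"

lemma computes_monus: "computes \<beta> U monus_prog [m, n] (m - n)"
proof -
  have "computes \<beta> U (PrimRec (Proj 0) (Comp pred_prog [Proj 1])) [n, m] (m - n)"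
  proof (rule computes_PrimRec)
    show "computes \<beta> U (Comp pred_prog [Proj 1]) [i, m - i, m] (m - Suc i)" for i
      by (rule computes_Comp1[OF computes_pred[of \<beta> U "m - i", simplified]])
        (simp add: computes_Proj)
  qed (auto intro: computes_Proj)
  then show ?thesis
    unfolding monus_prog_def by (rule computes_Comp2) (simp_all add: computes_Proj)
qed

definition mind_changes :: "(nat \<Rightarrow> nat) \<Rightarrow> nat set" where
  "mind_changes u = {s. u s \<noteq> u (Suc s)}"

text \<open>This recursion in the stage underlies both the monotonicity and the computability of
  \<open>changes_left\<close>.\<close>

lemma card_mind_changes_Suc:
  "card (mind_changes u \<inter> {..<Suc s}) = card (mind_changes u \<inter> {..<s}) + of_bool (u s \<noteq> u (Suc s))"
proof -
  have "mind_changes u \<inter> {..<Suc s} =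
      (if u s \<noteq> u (Suc s) then insert s (mind_changes u \<inter> {..<s}) else mind_changes u \<inter> {..<s})"
    by (auto simp: mind_changes_def less_Suc_eq)
  then show ?thesis
    by simp
qed

text \<open>A subset of a finite set with at least as many elements is the whole set. So no change
  occurs at or after \<open>s\<close>, and \<open>u\<close> is constant from there on.\<close>

lemma limit_after_last_mind_change:
  assumes lim: "u \<longlonglongrightarrow> l" and fin: "finite (mind_changes u)"
    and all_seen: "card (mind_changes u) \<le> card (mind_changes u \<inter> {..<s})"
  shows "u s = l"
proof -
  have seen: "mind_changes u \<inter> {..<s} = mind_changes u"
    by (rule card_seteq[OF fin Int_lower1 all_seen])
  have const: "u (Suc t) = u t" if "s \<le> t" for t
  proof -
    have "t \<notin> mind_changes u"
      using seen that by (metis IntD2 leD lessThan_iff)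
    then show ?thesis
      by (simp add: mind_changes_def)
  qed
  have "u t = u s" if "s \<le> t" for t
    using that by (induction rule: dec_induct) (simp_all add: const)
  then have "u \<longlonglongrightarrow> u s"
    by (intro tendsto_eventually eventually_sequentiallyI)
  then show ?thesis
    using lim by (rule LIMSEQ_unique)
qed

definition changes_left :: "(nat \<Rightarrow> nat \<Rightarrow> nat) \<Rightarrow> (nat \<Rightarrow> nat) \<Rightarrow> nat \<Rightarrow> nat \<Rightarrow> nat" where
  "changes_left g h x s = h x - card (mind_changes (g x) \<inter> {..<s})"

lemma changes_left_antimono: "changes_left g h x (Suc s) \<le> changes_left g h x s"
  by (simp add: changes_left_def card_mind_changes_Suc)

text \<open>A finite set of changes lies below some \<open>k\<close>, so from stage \<open>k\<close>
  on all of them have been counted.\<close>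

lemma changes_left_tendsto:
  assumes "finite (mind_changes (g x))"
  shows "changes_left g h x \<longlonglongrightarrow> h x - card (mind_changes (g x))"
proof -
  obtain k where "mind_changes (g x) \<subseteq> {..<k}"
    using assms by (auto simp: finite_nat_set_iff_bounded)
  then have "mind_changes (g x) \<inter> {..<s} = mind_changes (g x)" if "k \<le> s" for s
    using that by auto
  then show ?thesis
    unfolding changes_left_def by (intro tendsto_eventually eventually_sequentiallyI[of k]) simp
qed

text \<open>
  The two truncated differences of \<open>g x s\<close> and \<open>g x (Suc s)\<close> are not both positive, so at most
  one is subtracted in each step.
\<close>

lemma computable2_changes_left:
  assumes "computable2 g" "computable h"
  shows "computable2 (changes_left g h)"
proof -
  obtain eg eh where eg: "\<And>x s. computes (\<lambda>_. 0) {} eg [x, s] (g x s)"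
    and eh: "\<And>x. computes (\<lambda>_. 0) {} eh [x] (h x)"
    using assms unfolding computable_def computable2_def by blast
  \<comment> \<open>A step of the recursion on the stage receives \<open>[s, r, x]\<close>, where
    \<open>r\<close> is the previous value.\<close>
  define now where "now = Comp eg [Proj 2, Proj 0]"
  define later where "later = Comp eg [Proj 2, Comp Succ [Proj 0]]"
  define up where "up = Comp sgn_prog [Comp monus_prog [later, now]]"
  define down where "down = Comp sgn_prog [Comp monus_prog [now, later]]"
  define step where "step = Comp monus_prog [Comp monus_prog [Proj 1, up], down]"
  have now: "computes (\<lambda>_. 0) {} now [s, r, x] (g x s)" for s r x
    unfolding now_def by (rule computes_Comp2[OF eg]) (simp_all add: computes_Proj)
  have later: "computes (\<lambda>_. 0) {} later [s, r, x] (g x (Suc s))" for s r x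
    unfolding later_def
    by (rule computes_Comp2[OF eg _ computes_Comp1[OF computes.succ]]) (simp_all add: computes_Proj)
  have up: "computes (\<lambda>_. 0) {} up [s, r, x] (of_bool (g x (Suc s) - g x s \<noteq> 0))" for s r x
    unfolding up_def
    by (rule computes_Comp1[OF computes_sgn computes_Comp2[OF computes_monus later now]])
  have down: "computes (\<lambda>_. 0) {} down [s, r, x] (of_bool (g x s - g x (Suc s) \<noteq> 0))" for s r x
    unfolding down_def
    by (rule computes_Comp1[OF computes_sgn computes_Comp2[OF computes_monus now later]])
  have step: "computes (\<lambda>_. 0) {} step [s, changes_left g h x s, x] (changes_left g h x (Suc s))"
    for s x
  proof -
    have "computes (\<lambda>_. 0) {} step [s, r, x]
        (r - of_bool (g x (Suc s) - g x s \<noteq> 0) - of_bool (g x s - g x (Suc s) \<noteq> 0))" for r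
      unfolding step_def
      by (rule computes_Comp2[OF computes_monus computes_Comp2[OF computes_monus _ up] down])
        (simp add: computes_Proj)
    moreover have "changes_left g h x s - of_bool (g x (Suc s) - g x s \<noteq> 0)
        - of_bool (g x s - g x (Suc s) \<noteq> 0) = changes_left g h x (Suc s)"
      by (cases "g x s" "g x (Suc s)" rule: linorder_cases)
        (simp_all add: changes_left_def card_mind_changes_Suc)
    ultimately show ?thesis
      by metis
  qed
  \<comment> \<open>No change is counted before stage 0, so the recursion starts from
    \<open>h x\<close>.\<close>
  have "computes (\<lambda>_. 0) {} (PrimRec eh step) [s, x] (changes_left g h x s)" for s x
    by (rule computes_PrimRec[where r = "changes_left g h x", OF _ step])
      (simp add: changes_left_def eh)
  then have "computes (\<lambda>_. 0) {} (Comp (PrimRec eh step) [Proj 1, Proj 0]) [x, s]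
      (changes_left g h x s)" for x s
    by (rule computes_Comp2) (simp_all add: computes_Proj)
  then show ?thesis
    unfolding computable2_def by blast
qed

text \<open>The reduction searches for the least \<open>s\<close> with
  \<open>c x s \<le> \<beta> x\<close> and outputs \<open>g x s\<close>; \<open>reaches\<close>
  makes the search halt and \<open>settled\<close> makes the output correct.\<close>

lemma bT_reducible_if_settled:
  assumes g: "computable2 g" and c: "computable2 c"
    and reaches: "\<And>x. \<exists>s. c x s \<le> \<beta> x"
    and settled: "\<And>x s. c x s \<le> \<beta> x \<Longrightarrow> g x s = f x"
  shows "f \<le>\<^sub>b\<^sub>T \<beta>"
proof -
  obtain eg ec where eg: "\<And>x s. computes (\<lambda>_. 0) {} eg [x, s] (g x s)"
    and ec: "\<And>x s. computes (\<lambda>_. 0) {} ec [x, s] (c x s)"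
    using g c unfolding computable2_def by blast
  \<comment> \<open>The truncated difference \<open>c x s - \<beta> x\<close> vanishes exactly when
    \<open>c x s \<le> \<beta> x\<close>. \<open>Mu\<close> puts the search variable first, so the
    input is \<open>[s, x]\<close>.\<close>
  define test where "test = Comp monus_prog [Comp ec [Proj 1, Proj 0], Comp Oracle [Proj 1]]"
  have test: "computes \<beta> {y. y < Suc x} test [s, x] (c x s - \<beta> x)" for x s
    unfolding test_def
    by (rule computes_Comp2[OF computes_monus computes_Comp2[OF computes_mono[OF ec]]
          computes_Comp1[OF computes.query]])
      (simp_all add: computes_Proj)
  have "computes \<beta> {y. y < Suc x} (Comp eg [Proj 0, Mu test]) [x] (f x)" for x
  proof -
    define s where "s = (LEAST s. c x s \<le> \<beta> x)"
    have s: "c x s \<le> \<beta> x"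
      unfolding s_def using reaches by (rule LeastI_ex)
    have "\<exists>k. computes \<beta> {y. y < Suc x} test [m, x] (Suc k)" if "m < s" for m
    proof -
      have "\<beta> x < c x m"
        using not_less_Least[OF that[unfolded s_def]] by simp
      then obtain k where "c x m - \<beta> x = Suc k"
        by (metis Suc_diff_Suc)
      then show ?thesis
        using test[of x m] by metis
    qed
    moreover have "computes \<beta> {y. y < Suc x} test [s, x] 0"
      using test[of x s] s by simp
    ultimately have "computes \<beta> {y. y < Suc x} (Mu test) [x] s"
      by (intro computes.mu)
    moreover have "computes \<beta> {y. y < Suc x} (Proj 0) [x] x"
      by (simp add: computes_Proj)
    moreover have "computes \<beta> {y. y < Suc x} eg [x, s] (f x)"
      using computes_mono[OF eg[of x s]] settled[OF s] by simp
    ultimately show ?thesis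
      by (intro computes_Comp2)
  qed
  \<comment> \<open>The only query is at \<open>x\<close>, and queries must lie strictly below the
    bound; hence \<open>Suc\<close>.\<close>
  moreover have "computable Suc"
    unfolding computable_def by (blast intro: computes.succ)
  ultimately show ?thesis
    unfolding bT_reducible_def by blast
qed

theorem theorem3p8:
  fixes f :: "nat \<Rightarrow> nat"
  assumes "omega_approximable f"
  shows "\<exists>\<beta> :: nat \<Rightarrow> nat. approximable_from_above \<beta> \<and> f \<le>\<^sub>b\<^sub>T \<beta>"
proof -
  obtain g h where g: "computable2 g" and h: "computable h"
    and lim: "\<And>x. g x \<longlonglongrightarrow> f x"
    and fin: "\<And>x. finite (mind_changes (g x))"
    and bound: "\<And>x. card (mind_changes (g x)) \<le> h x"
    using assms unfolding omega_approximable_def mind_changes_def by metis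
  define \<beta> where "\<beta> x = h x - card (mind_changes (g x))" for x
  have c: "computable2 (changes_left g h)"
    using g h by (rule computable2_changes_left)
  have c_lim: "changes_left g h x \<longlonglongrightarrow> \<beta> x" for x
    unfolding \<beta>_def using fin by (rule changes_left_tendsto)
  have "approximable_from_above \<beta>"
    unfolding approximable_from_above_def
    by (intro exI[of _ "changes_left g h"] conjI allI c c_lim changes_left_antimono)
  moreover have "f \<le>\<^sub>b\<^sub>T \<beta>"
  proof (rule bT_reducible_if_settled[OF g c])
    \<comment> \<open>Convergence in the discrete topology is eventual equality, so the value
      \<open>\<beta> x\<close> is attained at some stage.\<close>
    fix x
    have "\<forall>\<^sub>F s in sequentially. changes_left g h x s = \<beta> x"
      using c_lim[of x] by (simp add: tendsto_discrete)
    then obtain s where "changes_left g h x s = \<beta> x"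
      using eventually_happens by force
    then show "\<exists>s. changes_left g h x s \<le> \<beta> x"
      by (intro exI[of _ s]) simp
  next
    fix x s assume "changes_left g h x s \<le> \<beta> x"
    \<comment> \<open>By \<open>bound\<close> the subtraction in \<open>\<beta> x\<close> is not
      truncated, so the inequality of differences reverses to one of cardinalities.\<close>
    then have "card (mind_changes (g x)) \<le> card (mind_changes (g x) \<inter> {..<s})"
      using bound[of x] unfolding changes_left_def \<beta>_def by linarith
    with lim fin show "g x s = f x"
      by (rule limit_after_last_mind_change)
  qed
  ultimately show ?thesis
    by blast
qed

end
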